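(* For all $n,m\ge1$ there exists a matrix $D_{n+1}^{(m)}\in\mathbb R^{(n+1)^{m+1}\times(n(m+1)+1)}$ (the $m$-th L-duplicating matrix) such that for all $x\in\mathbb R$ $$D_{n+1}^{(m)}\,H_{n(m+1)}(x)=vec\left(X_n^{(m)}(x)\right).$$ In particular, $D_{n+1}^{(m)}$ is given by the recursion $$D_{n+1}^{(1)}=D_{n+1,n+1},\qquad D_{n+1}^{(m)}=\left(I_{n+1}\otimes D_{n+1}^{(m-1)}\right)D_{nm+1,n+1}\quad(m\ge2).$$
   Context: $H_n(x)=(1,x,\dots,x^n)^{\top}$. $\otimes$ is the Kronecker product, $I_k$ the $k\times k$ identity, $\vec e_{k,j}$ the $j$-th canonical basis (column) vector of $\mathbb R^k$. $X_n^{(m)}(x):=(H_n(x)^{\top})^{\otimes m}\otimes H_n(x)\in\mathbb R^{(n+1)\times(n+1)^m}$. $vec$ stacks the columns of a matrix into one column vector. For $a,c\ge1$ the L-duplicating matrix is $$D_{a,c}=\sum_{i=1}^{a}\sum_{j=1}^{c}\vec e_{a+c-1,i+j-1}^{\top}\otimes\vec e_{c,j}\otimes\vec e_{a,i}\in\mathbb R^{ac\times(a+c-1)}.$$ *)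

theory Defs
  imports Complex_Main "Jordan_Normal_Form.Matrix"
begin

text \<open>Matrix and vector indices of the library start at 0. Column vectors of length \<open>k\<close> are
  represented as \<open>k \<times> 1\<close> matrices throughout, so that they can be transposed and can occur
  in Kronecker products.\<close>

definition kronecker :: "real mat \<Rightarrow> real mat \<Rightarrow> real mat" (infixl \<open>\<otimes>\<^sub>K\<close> 75) where
  "A \<otimes>\<^sub>K B = mat (dim_row A * dim_row B) (dim_col A * dim_col B)
     (\<lambda>(i, j). A $$ (i div dim_row B, j div dim_col B) * B $$ (i mod dim_row B, j mod dim_col B))"

primrec kronecker_power :: "real mat \<Rightarrow> nat \<Rightarrow> real mat" where
  "kronecker_power A 0 = 1\<^sub>m 1"
| "kronecker_power A (Suc m) = A \<otimes>\<^sub>K kronecker_power A m"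

definition vectorize :: "real mat \<Rightarrow> real mat" where
  \<comment> \<open>columns stacked on top of each other, leftmost column first\<close>
  "vectorize A = mat (dim_row A * dim_col A) 1 (\<lambda>(k, _). A $$ (k mod dim_row A, k div dim_row A))"

definition basis_col :: "nat \<Rightarrow> nat \<Rightarrow> real mat" where
  \<comment> \<open>the position \<open>j\<close> counts from 1\<close>
  "basis_col k j = mat_of_cols k [unit_vec k (j - 1)]"

definition H :: "nat \<Rightarrow> real \<Rightarrow> real mat" where
  "H n x = mat (n + 1) 1 (\<lambda>(i, _). x ^ i)"

definition X :: "nat \<Rightarrow> nat \<Rightarrow> real \<Rightarrow> real mat" where
  "X n m x = kronecker_power (transpose_mat (H n x)) m \<otimes>\<^sub>K H n x"

definition L_dup :: "nat \<Rightarrow> nat \<Rightarrow> real mat" where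
  \<comment> \<open>\<open>mat\<close> has no additive type class, so sums are taken in the module of
     \<open>ac \<times> (a + c - 1)\<close> matrices; every summand lies in its carrier.\<close>
  "L_dup a c =
     (let M = module_mat TYPE(real) (a * c) (a + c - 1) in
      finsum M (\<lambda>i. finsum M (\<lambda>j.
        transpose_mat (basis_col (a + c - 1) (i + j - 1)) \<otimes>\<^sub>K basis_col c j \<otimes>\<^sub>K basis_col a i)
        {1..c}) {1..a})"

end

theory Submission
  imports Defs
begin

text \<open>Row \<open>r\<close> of \<open>L_dup a c\<close> has its only nonzero entry in column \<open>r div a + r mod a\<close>, so
  \<open>L_dup (p + 1) (q + 1)\<close> maps \<open>H (p + q) x\<close> to \<open>H q x \<otimes>\<^sub>K H p x\<close>. On the other side,
  associativity of \<open>\<otimes>\<^sub>K\<close> gives \<open>vectorize (X n (Suc m) x) = H n x \<otimes>\<^sub>K vectorize (X n m x)\<close>.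
  With \<open>p = n * (m + 1)\<close> and \<open>q = n\<close>, the mixed-product property of \<open>\<otimes>\<^sub>K\<close> then yields the
  induction step.\<close>

section \<open>Index arithmetic and Kronecker products\<close>

lemma sum_lessThan_mult:
  fixes f :: "nat \<Rightarrow> 'a::comm_monoid_add"
  shows "(\<Sum>k<a * b. f k) = (\<Sum>i<a. \<Sum>j<b. f (i * b + j))"
proof -
  have "(\<Sum>k<a * b. f k) = (\<Sum>i<a. \<Sum>k = i * b..<i * b + b. f k)"
    by (rule sum.nat_group [symmetric])
  also have "\<dots> = (\<Sum>i<a. \<Sum>j<b. f (i * b + j))"
    using sum.shift_bounds_nat_ivl [of f 0 "i * b" b for i]
    by (simp add: atLeast0LessThan add.commute)
  finally show ?thesis .
qed

lemma mod_less_if_less_mult: "k < a * b \<Longrightarrow> k mod b < (b::nat)"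
  by (cases "b = 0") auto

lemma dim_kronecker [simp]:
  "dim_row (A \<otimes>\<^sub>K B) = dim_row A * dim_row B"
  "dim_col (A \<otimes>\<^sub>K B) = dim_col A * dim_col B"
  by (simp_all add: kronecker_def)

lemma index_kronecker:
  "i < dim_row A * dim_row B \<Longrightarrow> j < dim_col A * dim_col B \<Longrightarrow>
   (A \<otimes>\<^sub>K B) $$ (i, j) =
     A $$ (i div dim_row B, j div dim_col B) * B $$ (i mod dim_row B, j mod dim_col B)"
  by (simp add: kronecker_def)

lemma kronecker_carrier:
  "A \<in> carrier_mat a b \<Longrightarrow> B \<in> carrier_mat c d \<Longrightarrow> A \<otimes>\<^sub>K B \<in> carrier_mat (a * c) (b * d)"
  by (rule carrier_matI) (simp_all only: dim_kronecker carrier_matD)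

text \<open>Both bracketings read an index as the same three mixed-radix digits, one for each
  factor.\<close>

lemma kronecker_assoc: "A \<otimes>\<^sub>K B \<otimes>\<^sub>K C = A \<otimes>\<^sub>K (B \<otimes>\<^sub>K C)"
proof (rule eq_matI)
  have div_mod: "k div c div b = k div (b * c)" "k div c mod b = k mod (b * c) div c"
      "k mod c = k mod (b * c) mod c" for k b c :: nat
    unfolding mult.commute [of b c] by (cases "c = 0"; simp add: div_mult2_eq mod_mult2_eq)+
  have less: "k div c < a * b" "k mod (b * c) < b * c" if "k < a * b * c" for k a b c :: nat
    using that less_mult_imp_div_less [of k "a * b" c] mod_less_if_less_mult [of k a "b * c"]
    by (simp_all only: mult.assoc)
  fix i j
  assume "i < dim_row (A \<otimes>\<^sub>K (B \<otimes>\<^sub>K C))" "j < dim_col (A \<otimes>\<^sub>K (B \<otimes>\<^sub>K C))"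
  then have ij: "i < dim_row A * dim_row B * dim_row C" "j < dim_col A * dim_col B * dim_col C"
    by (simp_all only: dim_kronecker mult.assoc)
  show "(A \<otimes>\<^sub>K B \<otimes>\<^sub>K C) $$ (i, j) = (A \<otimes>\<^sub>K (B \<otimes>\<^sub>K C)) $$ (i, j)"
    \<comment> \<open>In \<open>div_mod(3)\<close> the radix \<open>b\<close> occurs only on the
      right, so it is applied at fixed instances to align the index of \<open>C\<close>.\<close>
    using ij less [OF ij(1)] less [OF ij(2)]
    by (simp only: index_kronecker dim_kronecker div_mod(1,2) mult.assoc)
      (simp only: div_mod(3) [of i "dim_row C" "dim_row B"] div_mod(3) [of j "dim_col C" "dim_col B"])
qed (simp_all only: dim_kronecker mult.assoc)

lemma kronecker_one_left: "1\<^sub>m 1 \<otimes>\<^sub>K A = A"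
  by (rule eq_matI) (auto simp: index_kronecker)

lemma kronecker_one_one: "1\<^sub>m a \<otimes>\<^sub>K 1\<^sub>m b = (1\<^sub>m (a * b) :: real mat)"
proof (rule eq_matI)
  fix i j
  assume "i < dim_row (1\<^sub>m (a * b) :: real mat)" "j < dim_col (1\<^sub>m (a * b) :: real mat)"
  moreover have "i = j \<longleftrightarrow> i div b = j div b \<and> i mod b = j mod b"
    by (metis div_mult_mod_eq)
  ultimately show "(1\<^sub>m a \<otimes>\<^sub>K 1\<^sub>m b) $$ (i, j) = (1\<^sub>m (a * b) :: real mat) $$ (i, j)"
    by (auto simp: index_kronecker less_mult_imp_div_less mod_less_if_less_mult)
qed simp_all

text \<open>The inner summation index splits into a quotient and a remainder modulo
  \<open>dim_row D\<close>. The resulting double sum factors into one sum for \<open>A * C\<close>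
  and one for \<open>B * D\<close>.\<close>

lemma kronecker_mult_kronecker:
  assumes "dim_col A = dim_row C" "dim_col B = dim_row D"
  shows "(A \<otimes>\<^sub>K B) * (C \<otimes>\<^sub>K D) = (A * C) \<otimes>\<^sub>K (B * D)"
proof (rule eq_matI)
  fix i j
  assume "i < dim_row ((A * C) \<otimes>\<^sub>K (B * D))" "j < dim_col ((A * C) \<otimes>\<^sub>K (B * D))"
  then have i: "i < dim_row A * dim_row B" and j: "j < dim_col C * dim_col D"
    by simp_all
  have less: "k * b + l < a * b" if "k < a" "l < b" for k l a b :: nat
  proof -
    have "k * b + l < Suc k * b" using that by simp
    also have "\<dots> \<le> a * b" using that by (intro mult_le_mono1) simp
    finally show ?thesis .
  qed
  let ?r = "dim_row C" and ?s = "dim_row D"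
  have "((A \<otimes>\<^sub>K B) * (C \<otimes>\<^sub>K D)) $$ (i, j)
      = (\<Sum>k<?r * ?s. (A \<otimes>\<^sub>K B) $$ (i, k) * (C \<otimes>\<^sub>K D) $$ (k, j))"
    using i j assms by (simp add: scalar_prod_def atLeast0LessThan)
  also have "\<dots> = (\<Sum>k<?r. \<Sum>l<?s. (A \<otimes>\<^sub>K B) $$ (i, k * ?s + l) * (C \<otimes>\<^sub>K D) $$ (k * ?s + l, j))"
    by (rule sum_lessThan_mult)
  also have "\<dots> = (\<Sum>k<?r. \<Sum>l<?s.
      (A $$ (i div dim_row B, k) * C $$ (k, j div dim_col D)) *
      (B $$ (i mod dim_row B, l) * D $$ (l, j mod dim_col D)))"
    using i j assms by (intro sum.cong refl) (simp add: index_kronecker less)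
  also have "\<dots> = ((A * C) \<otimes>\<^sub>K (B * D)) $$ (i, j)"
    using i j assms
    by (simp add: index_kronecker scalar_prod_def atLeast0LessThan less_mult_imp_div_less
        mod_less_if_less_mult sum_product)
  finally show "((A \<otimes>\<^sub>K B) * (C \<otimes>\<^sub>K D)) $$ (i, j) = ((A * C) \<otimes>\<^sub>K (B * D)) $$ (i, j)" .
qed simp_all

section \<open>Vectorization and the matrices \<open>X\<close>\<close>

text \<open>As \<open>u\<close> is a column, the left matrix consists of the scaled copies of
  \<open>A\<close> by the entries of \<open>u\<close>, side by side. Stacking their columns stacks
  the scaled copies of \<open>vectorize A\<close>.\<close>

lemma vectorize_transpose_kronecker:
  assumes "dim_col u = 1"
  shows "vectorize (transpose_mat u \<otimes>\<^sub>K A) = u \<otimes>\<^sub>K vectorize A"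
proof (rule eq_matI)
  fix i j
  assume "i < dim_row (u \<otimes>\<^sub>K vectorize A)" "j < dim_col (u \<otimes>\<^sub>K vectorize A)"
  then have i: "i < dim_row u * (dim_row A * dim_col A)" and j: "j = 0"
    using assms by (simp_all add: vectorize_def)
  from i have i': "i < dim_row A * (dim_row u * dim_col A)"
    by (simp add: ac_simps)
  have "i div dim_row A < dim_row u * dim_col A"
    using i' by (simp add: less_mult_imp_div_less mult.commute)
  moreover have "i mod dim_row A < dim_row A"
    using i' by (cases "dim_row A = 0") auto
  \<comment> \<open>The left side first splits off the row within \<open>A\<close>, the right side
    first the block of \<open>u\<close>; these identities match the digits.\<close>
  moreover have "i mod (dim_row A * dim_col A) div dim_row A = i div dim_row A mod dim_col A"
    "i mod (dim_row A * dim_col A) mod dim_row A = i mod dim_row A"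
    using i by (cases "dim_row A = 0"; simp add: mod_mult2_eq)+
  ultimately show "vectorize (transpose_mat u \<otimes>\<^sub>K A) $$ (i, j) = (u \<otimes>\<^sub>K vectorize A) $$ (i, j)"
    using i i' j assms
    by (simp add: vectorize_def index_kronecker less_mult_imp_div_less mod_less_if_less_mult
        div_mult2_eq)
qed (use assms in \<open>simp_all add: vectorize_def\<close>)

lemma H_carrier [simp]: "H n x \<in> carrier_mat (n + 1) 1"
  by (simp add: H_def)

lemma dim_H [simp]: "dim_row (H n x) = n + 1" "dim_col (H n x) = 1"
  by (simp_all add: H_def)

lemma vectorize_X_0: "vectorize (X n 0 x) = H n x"
  unfolding X_def kronecker_power.simps kronecker_one_left
  by (rule eq_matI) (auto simp: vectorize_def H_def)

lemma vectorize_X_Suc: "vectorize (X n (Suc m) x) = H n x \<otimes>\<^sub>K vectorize (X n m x)"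
  by (simp add: X_def kronecker_assoc vectorize_transpose_kronecker)

section \<open>Sums of matrices and the entries of \<open>L_dup\<close>\<close>

text \<open>Makes the inner sums of \<open>L_dup\<close> admissible summands of the outer
  one.\<close>

lemma finsum_module_mat_carrier:
  fixes f :: "'b \<Rightarrow> 'a::comm_ring_1 mat"
  assumes "\<And>k. k \<in> S \<Longrightarrow> f k \<in> carrier_mat r c"
  shows "finsum (module_mat TYPE('a) r c) f S \<in> carrier_mat r c"
proof -
  interpret abelian_group "module_mat TYPE('a) r c"
    by (rule abelian_group_mat)
  show ?thesis
    using assms finsum_closed [of f S] by (simp add: module_mat_simps Pi_def)
qed

lemma index_finsum_module_mat:
  fixes f :: "'b \<Rightarrow> 'a::comm_ring_1 mat"
  assumes "finite S" "\<And>k. k \<in> S \<Longrightarrow> f k \<in> carrier_mat r c" "i < r" "j < c"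
  shows "finsum (module_mat TYPE('a) r c) f S $$ (i, j) = (\<Sum>k\<in>S. f k $$ (i, j))"
proof -
  interpret abelian_group "module_mat TYPE('a) r c"
    by (rule abelian_group_mat)
  show ?thesis
    using assms(1,2)
  proof (induction S rule: finite_induct)
    case empty
    then show ?case using assms by (simp add: module_mat_simps)
  next
    case (insert k S)
    then have "finsum (module_mat TYPE('a) r c) f (insert k S)
        = f k + finsum (module_mat TYPE('a) r c) f S"
      by (subst finsum_insert) (auto simp: module_mat_simps)
    then show ?case
      using insert assms finsum_module_mat_carrier [of S f r c] by auto
  qed
qed

lemma basis_col_carrier: "basis_col k j \<in> carrier_mat k 1"
  using mat_of_cols_carrier(1) [of k "[unit_vec k (j - 1)]"] by (simp add: basis_col_def)

lemma index_basis_col: "l < k \<Longrightarrow> basis_col k j $$ (l, 0) = (if l = j - 1 then 1 else 0)"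
  \<comment> \<open>For \<open>j - 1 \<ge> k\<close> the column is zero; truncated subtraction makes
    \<open>j = 0\<close> agree with \<open>j = 1\<close>.\<close>
  by (cases "j - 1 < k") (auto simp: basis_col_def mat_of_cols_def unit_vec_def)

lemma L_dup_summand_carrier:
  "transpose_mat (basis_col (a + c - 1) (i + j - 1)) \<otimes>\<^sub>K basis_col c j \<otimes>\<^sub>K basis_col a i
    \<in> carrier_mat (a * c) (a + c - 1)"
proof -
  have "transpose_mat (basis_col (a + c - 1) (i + j - 1)) \<in> carrier_mat 1 (a + c - 1)"
    using basis_col_carrier by (simp only: transpose_carrier_mat)
  from kronecker_carrier [OF kronecker_carrier [OF this basis_col_carrier [of c j]]
      basis_col_carrier [of a i]]
  show ?thesis
    by (simp only: mult_1_left mult_1_right mult.commute [of c a])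
qed

lemma L_dup_carrier [simp]: "L_dup a c \<in> carrier_mat (a * c) (a + c - 1)"
  unfolding L_dup_def Let_def
  by (rule finsum_module_mat_carrier, rule finsum_module_mat_carrier, rule L_dup_summand_carrier)

text \<open>The summand for \<open>i\<close> and \<open>j\<close> is the matrix unit with its one in
  row \<open>(j - 1) * a + (i - 1)\<close> and column \<open>i + j - 2\<close>, counted from 0. Row
  \<open>r\<close> thus selects exactly \<open>i = r mod a + 1\<close> and
  \<open>j = r div a + 1\<close>.\<close>

lemma index_L_dup:
  assumes "r < a * c" "k < a + c - 1"
  shows "L_dup a c $$ (r, k) = (if k = r div a + r mod a then 1 else 0)"
proof -
  have dims: "dim_row (basis_col p q) = p" "dim_col (basis_col p q) = 1" for p q
    by (rule carrier_matD [OF basis_col_carrier])+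
  have "r < c * a"
    using assms(1) by (simp only: mult.commute)
  then have r: "r div a < c" "r mod a < a"
    by (rule less_mult_imp_div_less, rule mod_less_if_less_mult)
  have "L_dup a c $$ (r, k) = (\<Sum>i\<in>{1..a}. \<Sum>j\<in>{1..c}.
      (transpose_mat (basis_col (a + c - 1) (i + j - 1)) \<otimes>\<^sub>K basis_col c j \<otimes>\<^sub>K basis_col a i) $$ (r, k))"
    unfolding L_dup_def Let_def
    by (subst index_finsum_module_mat
        | rule refl sum.cong index_finsum_module_mat finite_atLeastAtMost assms
          L_dup_summand_carrier finsum_module_mat_carrier)+
  also have "\<dots> = (\<Sum>i\<in>{1..a}. \<Sum>j\<in>{1..c}. if i = r mod a + 1 then
      if j = r div a + 1 then if k = r div a + r mod a then 1 else 0 else 0 else 0)"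
    using assms r
    by (intro sum.cong refl) (auto simp: index_kronecker dims index_basis_col mult.commute)
  \<comment> \<open>With the test on \<open>i\<close> moved out of the inner sum, both sums collapse
    to single terms, whose indices are in range by \<open>r\<close>.\<close>
  also have "\<dots> = (\<Sum>i\<in>{1..a}. if i = r mod a + 1 then \<Sum>j\<in>{1..c}.
      if j = r div a + 1 then if k = r div a + r mod a then 1 else 0 else 0 else 0)"
    by (intro sum.cong refl) auto
  also have "\<dots> = (if k = r div a + r mod a then 1 else 0)"
    using r by (simp add: Suc_le_eq)
  finally show ?thesis .
qed

text \<open>Row \<open>j * (p + 1) + i\<close> with \<open>i \<le> p\<close> selects
  \<open>x ^ (j + i)\<close>, the product of entry \<open>j\<close> of \<open>H q x\<close> and
  entry \<open>i\<close> of \<open>H p x\<close>.\<close>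

lemma L_dup_mult_H: "L_dup (p + 1) (q + 1) * H (p + q) x = H q x \<otimes>\<^sub>K H p x"
proof (rule eq_matI)
  have dims: "dim_row (L_dup (p + 1) (q + 1)) = (p + 1) * (q + 1)"
    "dim_col (L_dup (p + 1) (q + 1)) = p + q + 1"
    using L_dup_carrier [of "p + 1" "q + 1"] by auto
  fix r s
  assume "r < dim_row (H q x \<otimes>\<^sub>K H p x)" "s < dim_col (H q x \<otimes>\<^sub>K H p x)"
  then have r: "r < (p + 1) * (q + 1)" and s: "s = 0"
    by (simp_all add: mult.commute)
  define i j where "i = r mod (p + 1)" and "j = r div (p + 1)"
  have ij: "i \<le> p" "j \<le> q"
    using r less_mult_imp_div_less [of r "q + 1" "p + 1"]
    by (simp_all add: i_def j_def mult.commute less_Suc_eq_le)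
  have "(L_dup (p + 1) (q + 1) * H (p + q) x) $$ (r, s)
      = (\<Sum>k<p + q + 1. L_dup (p + 1) (q + 1) $$ (r, k) * H (p + q) x $$ (k, 0))"
    using r s dims by (simp add: scalar_prod_def atLeast0LessThan)
  also have "\<dots> = (\<Sum>k<p + q + 1. if k = j + i then x ^ k else 0)"
    using r by (intro sum.cong refl) (simp add: index_L_dup H_def i_def j_def)
  \<comment> \<open>The bounds \<open>ij\<close> place \<open>j + i\<close> inside the range of
    summation.\<close>
  also have "\<dots> = x ^ (j + i)"
    using ij by simp
  also have "\<dots> = (H q x \<otimes>\<^sub>K H p x) $$ (r, s)"
    using r s ij by (simp add: index_kronecker H_def power_add mult.commute i_def j_def)
  finally show "(L_dup (p + 1) (q + 1) * H (p + q) x) $$ (r, s) = (H q x \<otimes>\<^sub>K H p x) $$ (r, s)" .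
qed (use L_dup_carrier [of "p + 1" "q + 1"] in \<open>auto simp: mult.commute\<close>)

text \<open>Starting from the identity at \<open>m = 0\<close> makes the case \<open>m = 1\<close> an instance of the recursion.\<close>

primrec L_dup_iter :: "nat \<Rightarrow> nat \<Rightarrow> real mat" where
  "L_dup_iter n 0 = 1\<^sub>m (n + 1)"
| "L_dup_iter n (Suc m) = (1\<^sub>m (n + 1) \<otimes>\<^sub>K L_dup_iter n m) * L_dup (n * Suc m + 1) (n + 1)"

lemma L_dup_iter_carrier: "L_dup_iter n m \<in> carrier_mat ((n + 1) ^ (m + 1)) (n * (m + 1) + 1)"
proof (induction m)
  case (Suc m)
  have "1\<^sub>m (n + 1) \<otimes>\<^sub>K L_dup_iter n m
      \<in> carrier_mat ((n + 1) ^ (Suc m + 1)) ((n * Suc m + 1) * (n + 1))"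
    using kronecker_carrier [OF one_carrier_mat Suc.IH, of "n + 1"] by (simp add: algebra_simps)
  \<comment> \<open>The column count keeps the form \<open>a + c - 1\<close> from
    \<open>L_dup_carrier\<close>; it equals \<open>n * (Suc m + 1) + 1\<close>.\<close>
  then have "L_dup_iter n (Suc m)
      \<in> carrier_mat ((n + 1) ^ (Suc m + 1)) (n * Suc m + 1 + (n + 1) - 1)"
    unfolding L_dup_iter.simps by (rule mult_carrier_mat [OF _ L_dup_carrier])
  then show ?case
    by (simp add: algebra_simps)
qed simp

lemma L_dup_iter_mult_H: "L_dup_iter n m * H (n * (m + 1)) x = vectorize (X n m x)"
proof (induction m)
  case 0
  show ?case
    using left_mult_one_mat [OF H_carrier] by (simp add: vectorize_X_0)
next
  case (Suc m)
  let ?I = "1\<^sub>m (n + 1) :: real mat" and ?D = "L_dup_iter n m"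
    and ?L = "L_dup (n * Suc m + 1) (n + 1)"
  note carrier = L_dup_iter_carrier [of n m]
  have "?I \<otimes>\<^sub>K ?D \<in> carrier_mat ((n + 1) * (n + 1) ^ (m + 1)) ((n * Suc m + 1) * (n + 1))"
    using kronecker_carrier [OF one_carrier_mat carrier, of "n + 1"] by (simp add: algebra_simps)
  moreover have "?L \<in> carrier_mat ((n * Suc m + 1) * (n + 1)) (n * Suc m + n + 1)"
    using L_dup_carrier [of "n * Suc m + 1" "n + 1"] by simp
  \<comment> \<open>Here \<open>\<otimes>\<^sub>K\<close> binds tighter than \<open>*\<close>.
    Reassociating lets \<open>?L\<close> act first, splitting the long power vector into a Kronecker
    product on which \<open>?I\<close> and \<open>?D\<close> act separately.\<close>
  ultimately have "?I \<otimes>\<^sub>K ?D * ?L * H (n * Suc m + n) x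
      = ?I \<otimes>\<^sub>K ?D * (?L * H (n * Suc m + n) x)"
    by (rule assoc_mult_mat) (rule H_carrier)
  also have "\<dots> = (?I * H n x) \<otimes>\<^sub>K (?D * H (n * Suc m) x)"
    unfolding L_dup_mult_H using carrier by (intro kronecker_mult_kronecker) auto
  also have "\<dots> = vectorize (X n (Suc m) x)"
    using Suc.IH left_mult_one_mat [OF H_carrier] by (simp add: vectorize_X_Suc)
  finally show ?case
    by (simp add: algebra_simps)
qed

theorem proposition4p3:
  fixes n :: nat
  assumes "n \<ge> 1"
  shows "\<exists>D :: nat \<Rightarrow> real mat.
           (\<forall>m\<ge>1. D m \<in> carrier_mat ((n + 1) ^ (m + 1)) (n * (m + 1) + 1) \<and>
                  (\<forall>x. D m * H (n * (m + 1)) x = vectorize (X n m x))) \<and>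
           D 1 = L_dup (n + 1) (n + 1) \<and>
           (\<forall>m\<ge>2. D m = (1\<^sub>m (n + 1) \<otimes>\<^sub>K D (m - 1)) * L_dup (n * m + 1) (n + 1))"
proof (intro exI [of _ "L_dup_iter n"] conjI allI impI)
  show "L_dup_iter n 1 = L_dup (n + 1) (n + 1)"
    \<comment> \<open>At \<open>m = 1\<close> the left factor is a Kronecker product of two
      identities, hence the identity of size \<open>(n + 1) * (n + 1)\<close>.\<close>
    using left_mult_one_mat [OF L_dup_carrier [of "n + 1" "n + 1"]]
    by (simp add: kronecker_one_one)
  show "L_dup_iter n m = (1\<^sub>m (n + 1) \<otimes>\<^sub>K L_dup_iter n (m - 1)) * L_dup (n * m + 1) (n + 1)"
    if "2 \<le> m" for m
    using that by (cases m) simp_all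
qed (rule L_dup_iter_carrier L_dup_iter_mult_H)+

end
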